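(* Let $\mathcal{H}$ be a finite hypergraph in which every vertex has degree at most $\Delta$, and let $I(\mathcal{H},z)$ be its independence polynomial. If $z\in\mathbb{C}$ satisfies $|z|<2^{-\Delta}$, then $I(\mathcal{H},z)\neq 0$.
   Context: A hypergraph $\mathcal{H}=(V,E)$ consists of a finite vertex set $V$ and a finite collection $E$ of nonempty subsets of $V$ (the edges). The degree of a vertex is the number of edges containing it. A set $A\subseteq V$ is independent if no subset of $A$ is an edge of $\mathcal{H}$ (equivalently, every edge contains at least one vertex of $V\setminus A$). The independence polynomial is $I(\mathcal{H},z)=\sum_{A\subseteq V\text{ independent}} z^{|A|}$. *)

theory Defs
  imports Complex_Main
begin

(* Edges form a set (no multiplicities); finiteness of E follows from that of V. *)
definition hypergraph :: "'a set \<Rightarrow> 'a set set \<Rightarrow> bool" where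
  "hypergraph V E \<longleftrightarrow> finite V \<and> (\<forall>e\<in>E. e \<noteq> {} \<and> e \<subseteq> V)"

definition vertex_degree :: "'a set set \<Rightarrow> 'a \<Rightarrow> nat" where
  "vertex_degree E v = card {e \<in> E. v \<in> e}"

definition independent_set :: "'a set \<Rightarrow> 'a set set \<Rightarrow> 'a set \<Rightarrow> bool" where
  "independent_set V E A \<longleftrightarrow> A \<subseteq> V \<and> (\<forall>B. B \<subseteq> A \<longrightarrow> B \<notin> E)"

definition independence_poly :: "'a set \<Rightarrow> 'a set set \<Rightarrow> complex \<Rightarrow> complex" where
  "independence_poly V E z = (\<Sum>A | independent_set V E A. z ^ card A)"

end

theory Submission
  imports Defs
begin

text \<open>
  The proof gives every vertex \<open>v\<close> its own variable \<open>x v\<close> and shows that the multivariate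
  independence polynomial has no zero in the polydisc \<open>cmod (x v) < 1 / 2 ^ degree v\<close>.

  The coefficient of a set \<open>A\<close> in this polynomial is the product, over all edges \<open>e\<close>, of the
  indicators that \<open>A\<close> does not contain \<open>e\<close>. So it is the coefficientwise (Schur) product of the
  polynomials of the hypergraphs with the single edge \<open>e\<close>. The latter are easy: up to factors
  \<open>1 + x v\<close> from the vertices outside \<open>e\<close>, such a polynomial is
  \<open>(\<Prod>v\<in>e. 1 + x v) - (\<Prod>v\<in>e. x v)\<close>. If \<open>cmod (x v) < 1 / 2\<close> on \<open>e\<close>, then \<open>x v\<close> is closer
  to \<open>0\<close> than to \<open>-1\<close>, so the first product is strictly larger in modulus. Hence there is
  no zero in the polydisc with radius \<open>1 / 2\<close> at the vertices of \<open>e\<close> and radius \<open>1\<close> at all others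
  (\<open>single_edge_nonzero\<close>).

  Polydiscs free of zeros behave well under the Schur product of multiaffine polynomials: the
  radii multiply (\<open>Schur_product_nonzero\<close>). Each edge at \<open>v\<close> therefore contributes one factor
  \<open>1 / 2\<close> to the radius of \<open>v\<close>. The multiplication of radii is an instance of Asano
  contraction, the standard device in proofs of Lee--Yang type: from a polynomial in two copies of the
  variables one keeps only the diagonal terms, one vertex at a time. For one vertex this is a
  statement about a bi-affine polynomial \<open>a + b x + c y + d x y\<close>
  (\<open>biaffine_contraction_nonzero\<close>).
\<close>

section \<open>Asano contraction\<close>

text \<open>
  On the line \<open>x = r t\<close>, \<open>y = s t\<close> the bi-affine polynomial becomes a quadratic in \<open>t\<close> without
  roots in the open unit disc. If \<open>d \<noteq> 0\<close>, the product of its two roots is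
  \<open>a / (d r s)\<close>, so the only zero \<open>z = -a / d\<close> of \<open>a + d z\<close> has \<open>cmod z \<ge> r s\<close>.
\<close>
lemma biaffine_contraction_nonzero:
  fixes a b c d z :: complex and r s :: real
  assumes nz: "\<And>x y. cmod x < r \<Longrightarrow> cmod y < s \<Longrightarrow> a + b * x + c * y + d * (x * y) \<noteq> 0"
    and "r > 0" "s > 0" and z: "cmod z < r * s"
  shows "a + d * z \<noteq> 0"
proof
  assume root: "a + d * z = 0"
  have "a \<noteq> 0" using nz[of 0 0] assms(2,3) by simp
  with root have "d \<noteq> 0" by auto
  \<comment> \<open>The restriction to the line is \<open>p t\<^sup>2 + q t + a\<close>, with square root \<open>D\<close> of its
    discriminant and roots \<open>t1\<close>, \<open>t2\<close>.\<close>
  define p where "p = d * of_real r * of_real s"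
  define q where "q = b * of_real r + c * of_real s"
  define D where "D = csqrt (q\<^sup>2 - 4 * p * a)"
  define t1 where "t1 = (- q + D) / (2 * p)"
  define t2 where "t2 = (- q - D) / (2 * p)"
  have "p \<noteq> 0" using \<open>d \<noteq> 0\<close> assms(2,3) by (simp add: p_def)
  have D2: "D * D = q * q - 4 * p * a"
    by (metis D_def power2_csqrt power2_eq_square)
  have no_root: "cmod t \<ge> 1" if "(2 * p * t + q) * (2 * p * t + q) = D * D" for t
  proof (rule ccontr)
    have "4 * p * (a + q * t + p * (t * t)) = 0"
      using that D2 by (simp add: algebra_simps)
    hence quadratic: "a + q * t + p * (t * t) = 0" using \<open>p \<noteq> 0\<close> by simp
    assume "\<not> cmod t \<ge> 1"
    hence "cmod (of_real r * t) < r" "cmod (of_real s * t) < s"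
      using assms(2,3) by (simp_all add: norm_mult)
    from nz[OF this] quadratic show False
      by (simp add: p_def q_def algebra_simps)
  qed
  have "2 * p * t1 + q = D" "2 * p * t2 + q = - D"
    using \<open>p \<noteq> 0\<close> by (simp_all add: t1_def t2_def)
  hence "cmod t1 \<ge> 1" "cmod t2 \<ge> 1" by (simp_all add: no_root)
  hence "cmod (t1 * t2) \<ge> 1"
    unfolding norm_mult using mult_mono[of 1 "cmod t1" 1 "cmod t2"] by simp
  moreover have "t1 * t2 = a / p"
  proof -
    have "(2 * p * t1) * (2 * p * t2) = (- q + D) * (- q - D)"
      using \<open>p \<noteq> 0\<close> by (simp add: t1_def t2_def)
    also have "\<dots> = 4 * p * a" using D2 by (simp add: algebra_simps)
    finally show ?thesis using \<open>p \<noteq> 0\<close> by (simp add: field_simps)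
  qed
  moreover have "a = - (d * z)" using root by (simp add: eq_neg_iff_add_eq_0)
  hence "a / p = - (z / (of_real r * of_real s))"
    using \<open>d \<noteq> 0\<close> assms(2,3) by (simp add: p_def field_simps)
  ultimately have "1 \<le> cmod z / (r * s)"
    using assms(2,3) by (simp add: norm_divide norm_mult)
  with z assms(2,3) show False by (simp add: field_simps)
qed

lemma sum_Pow_insert:
  fixes f :: "'a set \<Rightarrow> 'b :: comm_monoid_add"
  assumes "finite V" "v \<notin> V"
  shows "(\<Sum>A\<in>Pow (insert v V). f A) = (\<Sum>A\<in>Pow V. f A + f (insert v A))"
proof -
  have "inj_on (insert v) (Pow V)" using assms(2) by (auto simp: inj_on_def)
  moreover have "Pow V \<inter> insert v ` Pow V = {}" using assms(2) by auto
  ultimately show ?thesis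
    using assms by (simp add: Pow_insert sum.union_disjoint sum.reindex sum.distrib)
qed

text \<open>
  The induction is over the vertices. Fixing the variables of one vertex \<open>v\<close> at \<open>x v = p\<close> and
  \<open>y v = q\<close> leaves two zero-free polynomials in the other variables, with coefficients \<open>f'\<close> and
  \<open>g'\<close> that are affine in \<open>p\<close> and \<open>q\<close>, respectively. By induction their Schur product does not
  vanish, and it is bi-affine in \<open>p\<close> and \<open>q\<close>. Contracting \<open>p\<close> and \<open>q\<close> to the single
  variable \<open>z v\<close> drops the mixed terms in which only one of the two sets contains \<open>v\<close>; what
  remains is the Schur product of the original polynomials.
\<close>
lemma Schur_product_nonzero:
  fixes f g :: "'a set \<Rightarrow> complex" and r s :: "'a \<Rightarrow> real"
  assumes "finite V"
    and "\<And>x. \<forall>v\<in>V. cmod (x v) < r v \<Longrightarrow> (\<Sum>A\<in>Pow V. f A * prod x A) \<noteq> 0"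
    and "\<And>y. \<forall>v\<in>V. cmod (y v) < s v \<Longrightarrow> (\<Sum>A\<in>Pow V. g A * prod y A) \<noteq> 0"
    and "\<forall>v\<in>V. r v > 0 \<and> s v > 0"
    and "\<forall>v\<in>V. cmod (z v) < r v * s v"
  shows "(\<Sum>A\<in>Pow V. f A * g A * prod z A) \<noteq> 0"
  using assms
proof (induction V arbitrary: f g rule: finite_induct)
  case empty
  then show ?case by simp
next
  case (insert v V)
  have prod_ins: "prod x (insert v A) = x v * prod x A" if "A \<in> Pow V"
    for x :: "'a \<Rightarrow> complex" and A
    using that insert.hyps by (subst prod.insert) (auto intro: finite_subset)
  have fix_variable: "(\<Sum>A\<in>Pow (insert v V). k A * prod (x(v := t)) A)
      = (\<Sum>A\<in>Pow V. (k A + k (insert v A) * t) * prod x A)"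
    for k :: "'a set \<Rightarrow> complex" and x t
  proof -
    have prod_upd: "prod (x(v := t)) A = prod x A" if "A \<in> Pow V" for A
      using that insert.hyps by (intro prod.cong) auto
    show ?thesis
      unfolding sum_Pow_insert[OF insert.hyps]
      by (intro sum.cong refl)
         (simp add: prod_ins prod_upd fun_upd_same algebra_simps del: Pow_iff fun_upd_apply)
  qed
  have "(\<Sum>A\<in>Pow V. f A * g A * prod z A)
      + (\<Sum>A\<in>Pow V. f (insert v A) * g (insert v A) * prod z A) * z v \<noteq> 0"
  proof (rule biaffine_contraction_nonzero[where r = "r v" and s = "s v"
        and b = "\<Sum>A\<in>Pow V. f (insert v A) * g A * prod z A"
        and c = "\<Sum>A\<in>Pow V. f A * g (insert v A) * prod z A"])
    fix p q assume pq: "cmod p < r v" "cmod q < s v"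
    define f' where "f' A = f A + f (insert v A) * p" for A
    define g' where "g' A = g A + g (insert v A) * q" for A
    have "(\<Sum>A\<in>Pow V. f' A * g' A * prod z A) \<noteq> 0"
    proof (rule insert.IH)
      fix x assume "\<forall>v\<in>V. cmod (x v) < r v"
      hence "(\<Sum>A\<in>Pow (insert v V). f A * prod (x(v := p)) A) \<noteq> 0"
        using pq by (intro insert.prems(1)) auto
      thus "(\<Sum>A\<in>Pow V. f' A * prod x A) \<noteq> 0"
        unfolding fix_variable f'_def .
    next
      fix y assume "\<forall>v\<in>V. cmod (y v) < s v"
      hence "(\<Sum>A\<in>Pow (insert v V). g A * prod (y(v := q)) A) \<noteq> 0"
        using pq by (intro insert.prems(2)) auto
      thus "(\<Sum>A\<in>Pow V. g' A * prod y A) \<noteq> 0"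
        unfolding fix_variable g'_def .
    qed (use insert.prems in auto)
    thus "(\<Sum>A\<in>Pow V. f A * g A * prod z A)
        + (\<Sum>A\<in>Pow V. f (insert v A) * g A * prod z A) * p
        + (\<Sum>A\<in>Pow V. f A * g (insert v A) * prod z A) * q
        + (\<Sum>A\<in>Pow V. f (insert v A) * g (insert v A) * prod z A) * (p * q) \<noteq> 0"
      by (simp add: f'_def g'_def sum_distrib_left sum.distrib algebra_simps)
  qed (use insert.prems in auto)
  moreover have "(\<Sum>A\<in>Pow (insert v V). f A * g A * prod z A)
      = (\<Sum>A\<in>Pow V. f A * g A * prod z A)
      + (\<Sum>A\<in>Pow V. f (insert v A) * g (insert v A) * prod z A) * z v"
    unfolding sum_Pow_insert[OF insert.hyps] sum.distrib sum_distrib_right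
    by (intro arg_cong2[where f = "(+)"] sum.cong refl) (simp add: prod_ins del: Pow_iff)
  ultimately show ?case by simp
qed

section \<open>Independence polynomials\<close>

lemma sum_Pow_prod:
  fixes x :: "'a \<Rightarrow> complex"
  assumes "finite V"
  shows "(\<Sum>A\<in>Pow V. prod x A) = (\<Prod>v\<in>V. 1 + x v)"
  using prod_add[OF assms, of x "\<lambda>_. 1"] by (simp add: add.commute)

lemma sum_Pow_avoiding_edge:
  fixes x :: "'a \<Rightarrow> complex"
  assumes "finite V" "e \<subseteq> V"
  shows "(\<Sum>A\<in>Pow V. of_bool (\<not> e \<subseteq> A) * prod x A)
    = (\<Prod>v\<in>V - e. 1 + x v) * ((\<Prod>v\<in>e. 1 + x v) - prod x e)"
proof -
  have "(\<Sum>A\<in>Pow V. of_bool (e \<subseteq> A) * prod x A) = (\<Sum>A\<in>{A\<in>Pow V. e \<subseteq> A}. prod x A)"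
    using assms(1) by (intro sum.mono_neutral_cong_right) auto
  also have "\<dots> = (\<Sum>B\<in>Pow (V - e). prod x (e \<union> B))"
    using assms(2)
    by (intro sum.reindex_bij_witness[of _ "\<lambda>B. e \<union> B" "\<lambda>A. A - e"]) (auto simp: Un_absorb1)
  also have "\<dots> = (\<Sum>B\<in>Pow (V - e). prod x e * prod x B)"
    using assms by (intro sum.cong prod.union_disjoint refl) (auto intro: finite_subset)
  also have "\<dots> = prod x e * (\<Prod>v\<in>V - e. 1 + x v)"
    using assms(1) by (simp add: sum_distrib_left[symmetric] sum_Pow_prod)
  finally have "(\<Sum>A\<in>Pow V. of_bool (e \<subseteq> A) * prod x A) = prod x e * (\<Prod>v\<in>V - e. 1 + x v)" .
  moreover have "(\<Sum>A\<in>Pow V. of_bool (\<not> e \<subseteq> A) * prod x A)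
      = (\<Sum>A\<in>Pow V. prod x A) - (\<Sum>A\<in>Pow V. of_bool (e \<subseteq> A) * prod x A)"
    unfolding sum_subtractf[symmetric] by (intro sum.cong) auto
  moreover have "(\<Prod>v\<in>V. 1 + x v) = (\<Prod>v\<in>V - e. 1 + x v) * (\<Prod>v\<in>e. 1 + x v)"
    using assms by (intro prod.subset_diff)
  ultimately show ?thesis
    using assms(1) by (simp add: sum_Pow_prod algebra_simps)
qed

text \<open>
  The factor of \<open>e\<close> in \<open>sum_Pow_avoiding_edge\<close> cannot vanish because \<open>cmod (x v) < cmod (1 + x v)\<close>
  on \<open>e\<close>. Multiplied over \<open>e\<close> this stays strict only for \<open>e \<noteq> {}\<close>; for the empty edge the sum
  is \<open>0\<close>.
\<close>
lemma single_edge_nonzero: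
  fixes x :: "'a \<Rightarrow> complex"
  assumes "finite V" "e \<subseteq> V" "e \<noteq> {}"
    and x: "\<forall>v\<in>V. cmod (x v) < (if v \<in> e then 1 / 2 else 1)"
  shows "(\<Sum>A\<in>Pow V. of_bool (\<not> e \<subseteq> A) * prod x A) \<noteq> 0"
proof -
  have "finite e" using assms(1,2) by (rule finite_subset[rotated])
  have less: "cmod (x v) < cmod (1 + x v)" if "v \<in> e" for v
  proof -
    have "cmod (x v) < 1 / 2" using x[rule_format, of v] that assms(2) by auto
    moreover have "1 \<le> cmod (1 + x v) + cmod (x v)"
      using norm_triangle_ineq4[of "1 + x v" "x v"] by simp
    ultimately show ?thesis by simp
  qed
  have "(\<Prod>v\<in>e. cmod (x v)) < (\<Prod>v\<in>e. cmod (1 + x v))"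
  proof -
    obtain u where u: "u \<in> e" using \<open>e \<noteq> {}\<close> by blast
    show ?thesis
    proof (rule prod_mono_strict[where i = u])
      fix v assume "v \<in> e"
      from less[OF this] show "0 \<le> cmod (x v) \<and> cmod (x v) \<le> cmod (1 + x v)" by simp
      from less[OF \<open>v \<in> e\<close>] show "0 < cmod (1 + x v)"
        by (rule le_less_trans[OF norm_ge_zero])
    qed (use u less \<open>finite e\<close> in auto)
  qed
  hence "(\<Prod>v\<in>e. 1 + x v) \<noteq> prod x e"
    by (metis less_irrefl prod_norm)
  moreover have "1 + x v \<noteq> 0" if "v \<in> V - e" for v
  proof
    assume "1 + x v = 0"
    hence "x v = - 1" by (simp add: add_eq_0_iff)
    with x that show False by auto
  qed
  hence "(\<Prod>v\<in>V - e. 1 + x v) \<noteq> 0" using assms(1) by simp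
  ultimately show ?thesis
    unfolding sum_Pow_avoiding_edge[OF assms(1,2)] by simp
qed

text \<open>
  Adding an edge \<open>e\<close> is a Schur product with the polynomial of the single edge \<open>e\<close>: it halves the
  radius at exactly those vertices whose degree goes up. Without edges the polynomial is
  \<open>\<Prod>v\<in>V. 1 + x v\<close>, which has no zero in the unit polydisc.
\<close>
lemma multivariate_independence_poly_nonzero:
  fixes x :: "'a \<Rightarrow> complex"
  assumes "finite V" "finite E" "\<forall>e\<in>E. e \<noteq> {} \<and> e \<subseteq> V"
    and "\<forall>v\<in>V. cmod (x v) < 1 / 2 ^ vertex_degree E v"
  shows "(\<Sum>A\<in>Pow V. of_bool (\<forall>e\<in>E. \<not> e \<subseteq> A) * prod x A) \<noteq> 0"
  using assms(2-)
proof (induction E arbitrary: x rule: finite_induct)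
  case empty
  have "1 + x v \<noteq> 0" if "v \<in> V" for v
  proof
    assume "1 + x v = 0"
    hence "x v = - 1" by (simp add: add_eq_0_iff)
    with empty that show False by (auto simp: vertex_degree_def)
  qed
  with \<open>finite V\<close> show ?case by (simp add: sum_Pow_prod)
next
  case (insert e E)
  have degree_insert:
    "1 / 2 ^ vertex_degree (insert e E) v
      = 1 / 2 ^ vertex_degree E v * (if v \<in> e then 1 / 2 else (1::real))" for v
  proof -
    have "{e' \<in> insert e E. v \<in> e'} =
        (if v \<in> e then insert e {e' \<in> E. v \<in> e'} else {e' \<in> E. v \<in> e'})"
      by auto
    thus ?thesis using insert.hyps by (simp add: vertex_degree_def)
  qed
  have "(\<Sum>A\<in>Pow V. of_bool (\<forall>e\<in>E. \<not> e \<subseteq> A) * of_bool (\<not> e \<subseteq> A) * prod x A) \<noteq> 0"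
  proof (rule Schur_product_nonzero[where r = "\<lambda>v. 1 / 2 ^ vertex_degree E v"
        and s = "\<lambda>v. if v \<in> e then 1 / 2 else 1"])
    fix y assume "\<forall>v\<in>V. cmod (y v) < (if v \<in> e then 1 / 2 else 1)"
    thus "(\<Sum>A\<in>Pow V. of_bool (\<not> e \<subseteq> A) * prod y A) \<noteq> 0"
      using assms(1) insert.prems(1) by (intro single_edge_nonzero) auto
  next
    show "\<forall>v\<in>V. cmod (x v) < 1 / 2 ^ vertex_degree E v * (if v \<in> e then 1 / 2 else 1)"
      using insert.prems(2) unfolding degree_insert .
  qed (use assms(1) insert in auto)
  thus ?case by (simp add: of_bool_conj mult_ac)
qed

theorem corollary1p6:
  fixes V :: "'a set" and E :: "'a set set" and \<Delta> :: nat and z :: complex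
  assumes "hypergraph V E"
    and "\<forall>v\<in>V. vertex_degree E v \<le> \<Delta>"
    and "cmod z < 1 / 2 ^ \<Delta>"
  shows "independence_poly V E z \<noteq> 0"
proof -
  have "finite V" and edges: "\<forall>e\<in>E. e \<noteq> {} \<and> e \<subseteq> V"
    using assms(1) by (auto simp: hypergraph_def)
  hence "finite E" by (intro finite_subset[of E "Pow V"]) auto
  have "cmod z < 1 / 2 ^ vertex_degree E v" if "v \<in> V" for v
  proof -
    have "(1::real) / 2 ^ \<Delta> \<le> 1 / 2 ^ vertex_degree E v"
      using assms(2) that by (intro divide_left_mono power_increasing) auto
    with assms(3) show ?thesis by linarith
  qed
  hence "(\<Sum>A\<in>Pow V. of_bool (\<forall>e\<in>E. \<not> e \<subseteq> A) * (\<Prod>v\<in>A. z)) \<noteq> 0"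
    using \<open>finite V\<close> \<open>finite E\<close> edges
    by (intro multivariate_independence_poly_nonzero) auto
  also have "(\<Sum>A\<in>Pow V. of_bool (\<forall>e\<in>E. \<not> e \<subseteq> A) * (\<Prod>v\<in>A. z)) = independence_poly V E z"
    unfolding independence_poly_def using \<open>finite V\<close>
    by (intro sum.mono_neutral_cong_right) (auto simp: independent_set_def)
  finally show ?thesis .
qed

end
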